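(* Let $b\ge2$ be an integer and let $(g_b(n))_{n\ge1}$ be the van der Corput sequence in base $b$. If $b\geq 3$, then $$\frac{1}{bN}\leq\delta_{\min}((g_b(n)),N)\leq \frac{b}{N}\quad\text{for all } N\ge 2.$$ If $b=2$, then $$\frac{1}{2N}\leq\delta_{\min}((g_2(n)),N)\leq \frac{1}{N}\quad\text{for all } N\ge2.$$
   Context: Van der Corput sequence: for an integer $b\ge2$ and $n\in\mathbb{N}$ write $n$ in base $b$ as $n=\sum_{i\ge0}a_ib^i$ with digits $0\le a_i<b$; then $g_b(n)=\sum_{i\ge0}\frac{a_i}{b^{i+1}}\in[0,1)$. Minimal gap: for $x\in\mathbb{R}$ let $\|x\|=\min_{k\in\mathbb{Z}}|x+k|$. For a sequence $(x_n)_{n\ge1}$ in $[0,1)$, $\delta_{\min}((x_n),N)=\min\{\|x_n-x_m\|:1\le n\ne m\le N\}$. *)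

theory Defs
  imports Complex_Main
begin

definition digit :: "nat \<Rightarrow> nat \<Rightarrow> nat \<Rightarrow> nat" where
  "digit b n i = (n div b ^ i) mod b"

lemma digit_less: "b \<ge> 2 \<Longrightarrow> digit b n i < b"
  by (simp add: digit_def)

lemma digit_eq_0:
  assumes "b \<ge> 2" "i \<ge> n"
  shows "digit b n i = 0"
proof -
  have "n \<le> i" by fact
  also have "i < 2 ^ i" by (rule less_exp)
  also have "(2::nat) ^ i \<le> b ^ i" using assms(1) by (intro power_mono) auto
  finally show ?thesis by (simp add: digit_def)
qed

(* These are the digits of n in base b. *)
lemma digit_expansion:
  assumes "b \<ge> 2"
  shows "n = (\<Sum>i<n. digit b n i * b ^ i)"
proof -
  have *: "n = (\<Sum>i<k. digit b n i * b ^ i) + (n div b ^ k) * b ^ k" for k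
  proof (induction k)
    case (Suc k)
    have "n div b ^ k = (n div b ^ Suc k) * b + digit b n k"
      by (metis digit_def div_mult2_eq div_mult_mod_eq power_Suc2)
    then have "(n div b ^ k) * b ^ k = (n div b ^ Suc k) * b ^ Suc k + digit b n k * b ^ k"
      by (simp add: algebra_simps)
    with Suc.IH show ?case by simp
  qed simp
  have "n < 2 ^ n" by (rule less_exp)
  also have "(2::nat) ^ n \<le> b ^ n" using assms by (intro power_mono) auto
  finally have "n div b ^ n = 0" by simp
  with *[of n] show ?thesis by simp
qed

(* The series has only finitely many nonzero terms. *)
definition vdc :: "nat \<Rightarrow> nat \<Rightarrow> real" where
  "vdc b n = (\<Sum>i. real (digit b n i) / real b ^ (i + 1))"

definition int_norm :: "real \<Rightarrow> real" where
  "int_norm x = (INF k::int. \<bar>x + of_int k\<bar>)"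

(* The infimum in the definition is a minimum. *)
lemma int_norm_attained: "\<exists>k::int. int_norm x = \<bar>x + of_int k\<bar>"
proof
  have "\<bar>x - of_int (round x)\<bar> \<le> \<bar>x + of_int k\<bar>" for k
    using round_diff_minimal[of x "- k"] by simp
  then show "int_norm x = \<bar>x + of_int (- round x)\<bar>"
    unfolding int_norm_def by (intro cInf_eq_minimum) (auto intro!: range_eqI[of _ _ "- round x"])
qed

(* Min is meaningful only for N \<ge> 2, where the set is nonempty. *)
definition delta_min :: "(nat \<Rightarrow> real) \<Rightarrow> nat \<Rightarrow> real" where
  "delta_min x N = Min {int_norm (x n - x m) | n m. n \<in> {1..N} \<and> m \<in> {1..N} \<and> n \<noteq> m}"

end

theory Submission
  imports Defs
begin

text \<open>
  If \<open>N < b ^ k\<close>, then \<open>b ^ k * vdc b n\<close> for \<open>n \<le> N\<close> is the number obtained by reversing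
  the \<open>k\<close> digits of \<open>n\<close>. Digit reversal is injective, so distinct points differ modulo 1 by at
  least \<open>1 / b ^ k\<close>. Conversely, if \<open>b ^ k \<le> N < b ^ (k + 1)\<close> with \<open>k \<ge> 1\<close>, then the indices
  \<open>b ^ (k - 1)\<close> and \<open>b ^ k\<close> give points at distance \<open>(b - 1) / b ^ (k + 1) < (b - 1) / N\<close>.
  As \<open>b - 1 = 1\<close> for \<open>b = 2\<close>, this bound covers both cases of the theorem.
\<close>

text \<open>Only the lowest \<open>k\<close> digits take part. Peeling off the lowest digit first
  gives the same recursion in \<open>n div b\<close> as \<open>vdc_rec\<close>.\<close>

fun digit_reversal :: "nat \<Rightarrow> nat \<Rightarrow> nat \<Rightarrow> nat" where
  "digit_reversal b 0 n = 0"
| "digit_reversal b (Suc k) n = (n mod b) * b ^ k + digit_reversal b k (n div b)"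

lemma digit_reversal_less:
  assumes "b \<ge> 2"
  shows "digit_reversal b k n < b ^ k"
proof (induction k arbitrary: n)
  case (Suc k)
  have "(n mod b) * b ^ k + digit_reversal b k (n div b) < (n mod b + 1) * b ^ k"
    using Suc.IH[of "n div b"] by simp
  also have "\<dots> \<le> b * b ^ k"
    using assms by (intro mult_right_mono) (simp_all add: Suc_le_eq)
  finally show ?case by simp
qed simp

text \<open>Division with remainder by \<open>b ^ k\<close> separates the last digit of the argument
  from the reversal of its other digits, so both can be recovered.\<close>

lemma digit_reversal_inj:
  assumes b: "b \<ge> 2"
  shows "n < b ^ k \<Longrightarrow> m < b ^ k \<Longrightarrow> digit_reversal b k n = digit_reversal b k m \<Longrightarrow> n = m"
proof (induction k arbitrary: n m)
  case (Suc k)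
  have split: "digit_reversal b (Suc k) l div b ^ k = l mod b"
    "digit_reversal b (Suc k) l mod b ^ k = digit_reversal b k (l div b)" for l
    using digit_reversal_less[OF b, of k "l div b"] b by simp_all
  have "l div b < b ^ k" if "l < b ^ Suc k" for l
    using that by (simp add: less_mult_imp_div_less mult.commute)
  then have "n div b = m div b"
    using Suc.IH[of "n div b" "m div b"] Suc.prems split(2) by metis
  moreover have "n mod b = m mod b"
    using Suc.prems(3) split(1) by metis
  ultimately show ?case by (metis div_mult_mod_eq)
qed simp

text \<open>The digits of \<open>n div b\<close> are those of \<open>n\<close> shifted by one place,
  so splitting off the first term of the series leaves a copy scaled by
  \<open>1 / b\<close>.\<close>

lemma vdc_rec:
  assumes "b \<ge> 2"
  shows "vdc b n = (real (n mod b) + vdc b (n div b)) / real b"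
proof -
  have summable: "summable (\<lambda>i. real (digit b m i) / real b ^ (i + 1))" for m
    by (rule summable_finite[of "{..<m}"]) (auto simp: digit_eq_0[OF assms])
  have "vdc b n = real (n mod b) / real b
      + (\<Sum>i. real (digit b n (Suc i)) / real b ^ (Suc i + 1))"
    using suminf_split_head[OF summable[of n]] by (simp add: vdc_def digit_def)
  also have "(\<lambda>i. real (digit b n (Suc i)) / real b ^ (Suc i + 1))
      = (\<lambda>i. real (digit b (n div b) i) / real b ^ (i + 1) / real b)"
    by (simp add: digit_def div_mult2_eq fun_eq_iff)
  also have "suminf \<dots> = vdc b (n div b) / real b"
    unfolding vdc_def by (rule suminf_divide[OF summable])
  finally show ?thesis by (simp add: add_divide_distrib)
qed

lemma vdc_0 [simp]: "vdc b 0 = 0"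
  by (simp add: vdc_def digit_def)

text \<open>Both sides satisfy the same recursion; \<open>n < b ^ k\<close> ensures that the
  reversal drops no nonzero digit.\<close>

lemma vdc_eq_digit_reversal:
  assumes "b \<ge> 2"
  shows "n < b ^ k \<Longrightarrow> vdc b n = real (digit_reversal b k n) / real b ^ k"
proof (induction k arbitrary: n)
  case (Suc k)
  have "n div b < b ^ k"
    using Suc.prems by (simp add: less_mult_imp_div_less mult.commute)
  from Suc.IH[OF this] show ?case
    using assms by (simp add: vdc_rec[of b n] field_simps)
qed simp

text \<open>The only nonzero digit of \<open>b ^ k\<close> is a 1 in position
  \<open>k\<close>.\<close>

lemma vdc_power:
  assumes "b \<ge> 2"
  shows "vdc b (b ^ k) = 1 / real b ^ Suc k"
proof (induction k)
  case 0
  show ?case using assms vdc_rec[of b 1] by simp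
next
  case (Suc k)
  then show ?case using assms vdc_rec[of b "b ^ Suc k"] by simp
qed

lemma int_norm_le: "int_norm x \<le> \<bar>x + of_int k\<bar>"
  unfolding int_norm_def by (rule cINF_lower) (auto intro: bdd_belowI[of _ 0])

lemma int_norm_le_1: "int_norm x \<le> 1"
  using int_norm_le[of x "- round x"] of_int_round_abs_le[of x]
  by (simp add: abs_minus_commute)

lemma int_norm_vdc_diff_ge:
  assumes b: "b \<ge> 2" and "n < b ^ k" "m < b ^ k" "n \<noteq> m"
  shows "1 / real b ^ k \<le> int_norm (vdc b n - vdc b m)"
proof -
  define d where "d = int (digit_reversal b k n) - int (digit_reversal b k m)"
  obtain j :: int where j: "int_norm (vdc b n - vdc b m) = \<bar>vdc b n - vdc b m + of_int j\<bar>"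
    using int_norm_attained by blast
  have "d \<noteq> 0"
    using digit_reversal_inj[OF assms(1-3)] \<open>n \<noteq> m\<close> by (auto simp: d_def)
  moreover have "\<bar>d\<bar> < int (b ^ k)"
    using digit_reversal_less[OF b, of k n] digit_reversal_less[OF b, of k m]
    unfolding d_def by linarith
  \<comment> \<open>A nonzero multiple of \<open>b ^ k\<close> has absolute value at least
    \<open>b ^ k\<close>. Hence no integer shift \<open>j\<close> cancels the difference, which
    after scaling by \<open>b ^ k\<close> is a nonzero integer.\<close>
  ultimately have "\<not> int (b ^ k) dvd d"
    by (meson dvd_imp_le_int not_le abs_of_nat order.trans abs_ge_self)
  then have "d + j * int (b ^ k) \<noteq> 0"
    by (metis dvd_add_left_iff dvd_triv_right dvd_0_right)
  then have "1 \<le> \<bar>d + j * int (b ^ k)\<bar>" by linarith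
  then have ge: "1 \<le> \<bar>real_of_int (d + j * int (b ^ k))\<bar>"
    by linarith
  have "vdc b n - vdc b m + of_int j = real_of_int (d + j * int (b ^ k)) / real b ^ k"
    using b by (simp add: d_def vdc_eq_digit_reversal[OF b assms(2)]
        vdc_eq_digit_reversal[OF b assms(3)] field_simps)
  then show ?thesis
    using ge j by (simp add: abs_divide divide_right_mono)
qed

lemma finite_gaps:
  fixes x :: "nat \<Rightarrow> real"
  shows "finite {int_norm (x n - x m) | n m. n \<in> {1..N} \<and> m \<in> {1..N} \<and> n \<noteq> m}"
  by (rule finite_subset[of _ "(\<lambda>(n, m). int_norm (x n - x m)) ` ({1..N} \<times> {1..N})"]) auto

lemma delta_min_le:
  assumes "n \<in> {1..N}" "m \<in> {1..N}" "n \<noteq> m"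
  shows "delta_min x N \<le> int_norm (x n - x m)"
  unfolding delta_min_def using assms by (intro Min_le finite_gaps) blast

lemma le_delta_min:
  assumes "N \<ge> 2"
    and "\<And>n m. n \<in> {1..N} \<Longrightarrow> m \<in> {1..N} \<Longrightarrow> n \<noteq> m \<Longrightarrow> c \<le> int_norm (x n - x m)"
  shows "c \<le> delta_min x N"
proof -
  \<comment> \<open>The pair 1, 2 shows that the set is nonempty, as \<open>Min_ge_iff\<close>
    requires.\<close>
  have "int_norm (x 1 - x 2) \<in> {int_norm (x n - x m) | n m. n \<in> {1..N} \<and> m \<in> {1..N} \<and> n \<noteq> m}"
    using assms(1) by (intro CollectI exI[of _ 1] exI[of _ 2]) simp
  then show ?thesis
    unfolding delta_min_def using assms(2) finite_gaps[of x N] by (subst Min_ge_iff) blast+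
qed

text \<open>With \<open>b ^ k \<le> N < b ^ (k + 1)\<close>, all indices have at most
  \<open>k + 1\<close> digits, and \<open>b ^ (k + 1) \<le> b * N\<close>.\<close>

lemma delta_min_vdc_ge:
  assumes "b \<ge> 2" "N \<ge> 2"
  shows "1 / (real b * real N) \<le> delta_min (vdc b) N"
proof -
  obtain k where k: "b ^ k \<le> N" "N < b ^ (k + 1)"
    using ex_power_ivl1[of b N] assms by auto
  have "real b ^ k \<le> real N"
    using k(1) by (metis of_nat_le_iff of_nat_power)
  then have "1 / (real b * real N) \<le> 1 / real b ^ Suc k"
    using assms by (intro divide_left_mono) (simp_all add: mult_left_mono)
  also have "\<dots> \<le> delta_min (vdc b) N"
    using k(2) assms by (intro le_delta_min int_norm_vdc_diff_ge) auto
  finally show ?thesis .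
qed

lemma delta_min_vdc_le:
  assumes "b \<ge> 2" "N \<ge> 2"
  shows "delta_min (vdc b) N \<le> (real b - 1) / real N"
proof -
  obtain k where k: "b ^ k \<le> N" "N < b ^ (k + 1)"
    using ex_power_ivl1[of b N] assms by auto
  show ?thesis
  proof (cases k)
    case 0
    \<comment> \<open>Here \<open>N < b\<close>, so \<open>N \<le> b - 1\<close> and the claimed
      bound is at least 1; the trivial bound \<open>int_norm_le_1\<close> suffices.\<close>
    then have "1 \<le> (real b - 1) / real N"
      using k assms by (simp add: field_simps)
    moreover have "delta_min (vdc b) N \<le> int_norm (vdc b 1 - vdc b 2)"
      using assms by (intro delta_min_le) auto
    ultimately show ?thesis
      using int_norm_le_1[of "vdc b 1 - vdc b 2"] by linarith
  next
    case (Suc j)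
    have less: "b ^ j < b ^ k" using assms by (simp add: Suc)
    have "delta_min (vdc b) N \<le> int_norm (vdc b (b ^ j) - vdc b (b ^ k))"
      using less less_imp_le[OF order.strict_trans2[OF less k(1)]] k(1) assms
      by (intro delta_min_le) auto
    also have "\<dots> \<le> \<bar>vdc b (b ^ j) - vdc b (b ^ k)\<bar>"
      using int_norm_le[of _ 0] by simp
    also have "vdc b (b ^ j) - vdc b (b ^ k) = (real b - 1) / real b ^ (k + 1)"
      \<comment> \<open>Since \<open>k = Suc j\<close>, the two points are \<open>1 / b ^ k\<close>
        and \<open>1 / b ^ (k + 1)\<close>.\<close>
      unfolding vdc_power[OF assms(1)] using assms by (simp add: Suc field_simps)
    also have "\<bar>\<dots>\<bar> = (real b - 1) / real b ^ (k + 1)"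
      using assms by simp
    also have "\<dots> \<le> (real b - 1) / real N"
    proof (rule divide_left_mono)
      show "real N \<le> real b ^ (k + 1)"
        using k(2) by (metis of_nat_le_iff of_nat_power less_imp_le)
    qed (use assms in simp_all)
    finally show ?thesis .
  qed
qed

theorem theorem1p5:
  fixes b :: nat
  assumes "b \<ge> 2"
  shows "(b \<ge> 3 \<longrightarrow> (\<forall>N::nat\<ge>2.
            1 / (real b * real N) \<le> delta_min (vdc b) N \<and> delta_min (vdc b) N \<le> real b / real N))
       \<and> (b = 2 \<longrightarrow> (\<forall>N::nat\<ge>2.
            1 / (2 * real N) \<le> delta_min (vdc 2) N \<and> delta_min (vdc 2) N \<le> 1 / real N))"
proof -
  have "delta_min (vdc b) N \<le> real b / real N" if "N \<ge> 2" for N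
    by (rule order.trans[OF delta_min_vdc_le[OF assms that]]) (simp add: divide_right_mono)
  then show ?thesis
    using delta_min_vdc_ge[of b] delta_min_vdc_ge[of 2] delta_min_vdc_le[of 2] assms by simp
qed

end
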